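(* The WMCBA achieves an approximation ratio of $1-1/e$ for the RMWTCSCLMS problem: for every instance, the total weight of the targets covered by the schedule it outputs is at least $(1-1/e)$ times the maximum possible total weight of covered targets, where $e$ is the base of the natural logarithm.
   Context: RMWTCSCLMS problem: given a sensing range $R_s>0$, a transmission range $R_t$ large enough that any two mobile sensors and any sensor and the data sink can communicate, a data sink, $n$ mobile sensors $S=\{s_1,\dots,s_n\}$ with initial positions in the plane (movable anywhere), and $m$ targets $T=\{t_1,\dots,t_m\}$ with positions and weights $t.\omega$, schedule the sensors to positions so as to maximize the total weight of covered targets, where a target is covered if it is within distance $R_s$ of some sensor. WMCBA: for targets $t_i,t_j$, let $p^1_{t_i,t_j},p^2_{t_i,t_j}$ be the (at most two) intersection points of the radius-$R_s$ circles centered at $t_i$ and $t_j$, and let $P_q$ be the set of targets within distance $R_s$ of a point $q$. (1) Form $U=\{u_1,\dots,u_m\}$ with weights $u_i.\tau=t_i.\omega$, the collection $C$ consisting of $\{u_i\}$ for each $t_i$ and $C_p=\{u_x:t_x\in P_p\}$ for each existing intersection point $p$, and $k=n$. (2) Greedily select sets from $C$, each time one with the maximum total weight of not-yet-covered elements, until $k$ sets are selected or all elements are covered. (3) For each selected singleton $\{u_z\}$ place a sensor within distance $R_s$ of $t_z$'s location, and for each selected $C_p$ place a sensor at $p$, assigning sensors to these points by the Hungarian method with cost = distance to the intersection point, or $\max(0,\text{distance}-R_s)$ to a target location, and $0$ for dummy points padding to $n$ points. *)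

theory Defs
  imports "HOL-Analysis.Analysis" "HOL-Combinatorics.Permutations"
begin

text \<open>Sensors are indexed by \<open>{..<num_sensors I}\<close> and targets by \<open>{..<num_targets I}\<close>;
  the functions below are irrelevant outside these ranges.\<close>

record rmwtcsclms =
  sensing_range :: real
  trans_range :: real
  sink :: "real^2"
  num_sensors :: nat
  init_pos :: "nat \<Rightarrow> real^2"
  num_targets :: nat
  target_pos :: "nat \<Rightarrow> real^2"
  target_weight :: "nat \<Rightarrow> real"

text \<open>No finite transmission range connects arbitrary pairs of points of the whole plane, so
  ``large enough'' refers to the bounded part of the plane in which sensors are useful: their
  initial positions, all positions from which some target is sensed, and the sink.\<close>

definition relevant_region :: "rmwtcsclms \<Rightarrow> (real^2) set" where
  "relevant_region I = {sink I} \<union> init_pos I ` {..<num_sensors I} \<union>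
     (\<Union>i<num_targets I. cball (target_pos I i) (sensing_range I))"

definition valid_instance :: "rmwtcsclms \<Rightarrow> bool" where
  "valid_instance I \<longleftrightarrow>
     sensing_range I > 0 \<and>
     (\<forall>i<num_targets I. target_weight I i \<ge> 0) \<and>
     (\<forall>p\<in>relevant_region I. \<forall>q\<in>relevant_region I. dist p q \<le> trans_range I)"

text \<open>A schedule maps each sensor to its final position.\<close>

definition communicating :: "rmwtcsclms \<Rightarrow> (nat \<Rightarrow> real^2) \<Rightarrow> bool" where
  "communicating I X \<longleftrightarrow>
     (\<forall>j<num_sensors I. dist (X j) (sink I) \<le> trans_range I) \<and>
     (\<forall>j<num_sensors I. \<forall>j'<num_sensors I. dist (X j) (X j') \<le> trans_range I)"

definition covered_targets :: "rmwtcsclms \<Rightarrow> (nat \<Rightarrow> real^2) \<Rightarrow> nat set" where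
  "covered_targets I X = {i. i < num_targets I \<and>
     (\<exists>j<num_sensors I. dist (X j) (target_pos I i) \<le> sensing_range I)}"

definition covered_weight :: "rmwtcsclms \<Rightarrow> (nat \<Rightarrow> real^2) \<Rightarrow> real" where
  "covered_weight I X = (\<Sum>i\<in>covered_targets I X. target_weight I i)"

text \<open>The maximum is over all placements in the plane, communicating or not, so
  the optimum is not lowered by the reading of ``large enough'' above.  It is a genuine maximum,
  since only finitely many values occur.\<close>

definition opt_weight :: "rmwtcsclms \<Rightarrow> real" where
  "opt_weight I = Max (range (covered_weight I))"

lemma finite_range_covered_weight: "finite (range (covered_weight I))"
proof (rule finite_subset)
  show "range (covered_weight I) \<subseteq> sum (target_weight I) ` Pow {..<num_targets I}"
    by (auto simp: covered_weight_def covered_targets_def)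
qed simp

definition targets_near :: "rmwtcsclms \<Rightarrow> real^2 \<Rightarrow> nat set" where
  "targets_near I q = {x. x < num_targets I \<and> dist (target_pos I x) q \<le> sensing_range I}"

text \<open>For targets at distinct positions there are at most two points per pair.  Coinciding
  positions are not excluded; their common circle then consists of intersection points.\<close>

definition intersection_points :: "rmwtcsclms \<Rightarrow> (real^2) set" where
  "intersection_points I = {p. \<exists>i<num_targets I. \<exists>j<num_targets I. i \<noteq> j \<and>
     p \<in> sphere (target_pos I i) (sensing_range I) \<inter> sphere (target_pos I j) (sensing_range I)}"

text \<open>The element \<open>u\<^sub>i\<close> of the maximum coverage instance is represented by the index \<open>i\<close>
  of its target, and its weight by the weight of the target.\<close>

definition mc_collection :: "rmwtcsclms \<Rightarrow> nat set set" where
  "mc_collection I =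
     {{i} |i. i < num_targets I} \<union> targets_near I ` intersection_points I"

text \<open>The possible sequences of selections; ties are broken arbitrarily.\<close>

inductive greedy :: "'a set set \<Rightarrow> ('a \<Rightarrow> real) \<Rightarrow> 'a set \<Rightarrow> nat \<Rightarrow> 'a set list \<Rightarrow> bool"
  for C :: "'a set set" and \<tau> :: "'a \<Rightarrow> real" and U :: "'a set" and k :: nat where
  start: "greedy C \<tau> U k []"
| select: "greedy C \<tau> U k Gs \<Longrightarrow> length Gs < k \<Longrightarrow> \<Union>(set Gs) \<noteq> U \<Longrightarrow> A \<in> C \<Longrightarrow>
    (\<And>B. B \<in> C \<Longrightarrow> sum \<tau> (B - \<Union>(set Gs)) \<le> sum \<tau> (A - \<Union>(set Gs))) \<Longrightarrow>
    greedy C \<tau> U k (Gs @ [A])"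

definition greedy_result ::
    "'a set set \<Rightarrow> ('a \<Rightarrow> real) \<Rightarrow> 'a set \<Rightarrow> nat \<Rightarrow> 'a set list \<Rightarrow> bool" where
  "greedy_result C \<tau> U k Gs \<longleftrightarrow> greedy C \<tau> U k Gs \<and> (length Gs = k \<or> \<Union>(set Gs) = U)"

datatype destination = Near_Target nat | At_Point "real^2" | Dummy

text \<open>Every \<open>targets_near I p\<close> with \<open>p\<close> an intersection point has at least two elements, so the
  two cases exclude each other.  If several intersection points induce the same set, any of them
  may be used.\<close>

definition destination_of :: "rmwtcsclms \<Rightarrow> nat set \<Rightarrow> destination \<Rightarrow> bool" where
  "destination_of I A d \<longleftrightarrow>
     (\<exists>z<num_targets I. A = {z} \<and> d = Near_Target z) \<or>
     (\<exists>p\<in>intersection_points I. A = targets_near I p \<and> d = At_Point p)"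

fun move_cost :: "rmwtcsclms \<Rightarrow> nat \<Rightarrow> destination \<Rightarrow> real" where
  "move_cost I j (Near_Target z) =
     max 0 (dist (init_pos I j) (target_pos I z) - sensing_range I)"
| "move_cost I j (At_Point p) = dist (init_pos I j) p"
| "move_cost I j Dummy = 0"

text \<open>The Hungarian method is specified by what it computes: a bijective assignment of
  sensors to destinations (\<open>\<sigma> j\<close> is the position in the list \<open>Ds\<close>) of minimum total cost.\<close>

definition min_cost_assignment ::
    "rmwtcsclms \<Rightarrow> destination list \<Rightarrow> (nat \<Rightarrow> nat) \<Rightarrow> bool" where
  "min_cost_assignment I Ds \<sigma> \<longleftrightarrow> \<sigma> permutes {..<num_sensors I} \<and>
     (\<forall>\<pi>. \<pi> permutes {..<num_sensors I} \<longrightarrow>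
        (\<Sum>j<num_sensors I. move_cost I j (Ds ! \<sigma> j)) \<le>
        (\<Sum>j<num_sensors I. move_cost I j (Ds ! \<pi> j)))"

fun placed_at :: "rmwtcsclms \<Rightarrow> nat \<Rightarrow> destination \<Rightarrow> real^2 \<Rightarrow> bool" where
  "placed_at I j (Near_Target z) q \<longleftrightarrow> dist q (target_pos I z) \<le> sensing_range I"
| "placed_at I j (At_Point p) q \<longleftrightarrow> q = p"
| "placed_at I j Dummy q \<longleftrightarrow> q = init_pos I j"

definition wmcba_output :: "rmwtcsclms \<Rightarrow> (nat \<Rightarrow> real^2) \<Rightarrow> bool" where
  "wmcba_output I X \<longleftrightarrow>
     (\<exists>Gs Ds \<sigma>.
        greedy_result (mc_collection I) (target_weight I) {..<num_targets I} (num_sensors I) Gs \<and>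
        list_all2 (destination_of I) Gs Ds \<and>
        min_cost_assignment I (Ds @ replicate (num_sensors I - length Ds) Dummy) \<sigma> \<and>
        (\<forall>j<num_sensors I.
           placed_at I j ((Ds @ replicate (num_sensors I - length Ds) Dummy) ! \<sigma> j) (X j)))"

lemma finite_mc_collection: "finite (mc_collection I)"
  by (rule finite_subset[of _ "Pow {..<num_targets I}"])
    (auto simp: mc_collection_def targets_near_def)

lemma greedy_subset: "greedy C \<tau> U k Gs \<Longrightarrow> set Gs \<subseteq> C"
  by (induction rule: greedy.induct) auto

lemma greedy_result_exists:
  assumes "finite C" "\<Union>C = U"
  shows "\<exists>Gs. greedy_result C \<tau> U k Gs"
proof -
  have "\<exists>Gs. greedy C \<tau> U k Gs \<and> (length Gs = l \<or> \<Union>(set Gs) = U)" if "l \<le> k" for l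
    using that
  proof (induction l)
    case 0
    show ?case by (rule exI[of _ "[]"]) (simp add: greedy.start)
  next
    case (Suc l)
    then obtain Gs where Gs: "greedy C \<tau> U k Gs" "length Gs = l \<or> \<Union>(set Gs) = U" by auto
    show ?case
    proof (cases "\<Union>(set Gs) = U")
      case True
      with Gs show ?thesis by blast
    next
      case False
      then have l: "length Gs = l" using Gs by simp
      have "C \<noteq> {}" using False greedy_subset[OF Gs(1)] assms by auto
      let ?A = "arg_min_on (\<lambda>B. - sum \<tau> (B - \<Union>(set Gs))) C"
      have "?A \<in> C"
        using arg_min_if_finite(1)[OF assms(1) \<open>C \<noteq> {}\<close>] .
      moreover have "sum \<tau> (B - \<Union>(set Gs)) \<le> sum \<tau> (?A - \<Union>(set Gs))" if "B \<in> C" for B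
        using arg_min_least[OF assms(1) \<open>C \<noteq> {}\<close> that,
            of "\<lambda>B. - sum \<tau> (B - \<Union>(set Gs))"] by simp
      ultimately obtain A where A: "A \<in> C"
          "\<And>B. B \<in> C \<Longrightarrow> sum \<tau> (B - \<Union>(set Gs)) \<le> sum \<tau> (A - \<Union>(set Gs))"
        by blast
      have "greedy C \<tau> U k (Gs @ [A])"
        by (rule greedy.select) (use Gs(1) l Suc.prems False A in auto)
      then show ?thesis using l by (intro exI[of _ "Gs @ [A]"]) simp
    qed
  qed
  from this[of k] show ?thesis by (auto simp: greedy_result_def)
qed

lemma min_cost_assignment_exists: "\<exists>\<sigma>. min_cost_assignment I Ds \<sigma>"
proof -
  let ?S = "{\<pi>. \<pi> permutes {..<num_sensors I}}"
  let ?f = "\<lambda>\<pi>. \<Sum>j<num_sensors I. move_cost I j (Ds ! \<pi> j)"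
  have fin: "finite ?S" by (simp add: finite_permutations)
  have ne: "?S \<noteq> {}" using permutes_id by blast
  have "arg_min_on ?f ?S \<in> ?S" by (rule arg_min_if_finite(1)[OF fin ne])
  moreover have "?f (arg_min_on ?f ?S) \<le> ?f \<pi>" if "\<pi> permutes {..<num_sensors I}" for \<pi>
    by (rule arg_min_least[OF fin ne]) (use that in simp)
  ultimately show ?thesis unfolding min_cost_assignment_def by blast
qed

lemma wmcba_output_exists:
  assumes "valid_instance I"
  shows "\<exists>X. wmcba_output I X"
proof -
  have un: "\<Union>(mc_collection I) = {..<num_targets I}"
  proof
    show "\<Union>(mc_collection I) \<subseteq> {..<num_targets I}"
      unfolding mc_collection_def targets_near_def by auto
    show "{..<num_targets I} \<subseteq> \<Union>(mc_collection I)"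
      unfolding mc_collection_def by blast
  qed
  obtain Gs where Gs:
      "greedy_result (mc_collection I) (target_weight I) {..<num_targets I} (num_sensors I) Gs"
    using greedy_result_exists[OF finite_mc_collection un] by (rule exE)
  then have "set Gs \<subseteq> mc_collection I"
    unfolding greedy_result_def by (intro greedy_subset) (erule conjunct1)
  moreover have "\<exists>d. destination_of I A d" if "A \<in> mc_collection I" for A
  proof -
    from that consider z where "z < num_targets I" "A = {z}"
      | p where "p \<in> intersection_points I" "A = targets_near I p"
      unfolding mc_collection_def by blast
    then show ?thesis
    proof cases
      case 1
      then have "destination_of I A (Near_Target z)" by (simp add: destination_of_def)
      then show ?thesis ..
    next
      case 2
      then have "destination_of I A (At_Point p)" unfolding destination_of_def by blast
      then show ?thesis ..
    qed
  qed
  ultimately have "\<forall>A\<in>set Gs. \<exists>d. destination_of I A d" by blast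
  then obtain f where "\<forall>A\<in>set Gs. destination_of I A (f A)" using bchoice by meson
  then have Ds: "list_all2 (destination_of I) Gs (map f Gs)"
    by (auto simp: list_all2_conv_all_nth)
  let ?L = "map f Gs @ replicate (num_sensors I - length (map f Gs)) Dummy"
  obtain \<sigma> where \<sigma>: "min_cost_assignment I ?L \<sigma>" using min_cost_assignment_exists by blast
  have "\<exists>q. placed_at I j d q" for j d
  proof (cases d)
    case (Near_Target z)
    then have "placed_at I j d (target_pos I z)"
      using assms by (simp add: valid_instance_def)
    then show ?thesis by blast
  qed auto
  then have "\<forall>j. \<exists>q. placed_at I j (?L ! \<sigma> j) q" by blast
  then have "\<exists>X. \<forall>j. placed_at I j (?L ! \<sigma> j) (X j)" by (rule choice)
  then obtain X where "\<forall>j. placed_at I j (?L ! \<sigma> j) (X j)" by blast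
  with Gs Ds \<sigma> show ?thesis
    unfolding wmcba_output_def
    by (intro exI[of _ X] exI[of _ Gs] exI[of _ "map f Gs"] exI[of _ \<sigma>]) simp
qed

end

theory Submission
  imports Defs
begin

text \<open>The points from which a nonempty set of targets is sensed form an intersection of discs of
  radius \<open>R\<^sub>s\<close>. Moving first to the boundary of this intersection and then along one bounding circle
  until another circle is met, one may take the sensor to be at an intersection point, or the set is
  a singleton. Hence each sensor of an optimal schedule covers a subset of some member of the
  collection \<open>C\<close>, and the usual analysis of greedy maximum coverage applies: every greedy selection
  reduces the gap to the optimum by a factor of \<open>1 - 1 / k\<close>, and \<open>(1 - 1 / k) ^ k \<le> 1 / e\<close>.\<close>

section \<open>Moving a sensor to an intersection point\<close>

text \<open>Intermediate value theorem for the largest of finitely many distances: this maximum is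
  continuous, at most \<open>r\<close> at \<open>x\<close> and at least \<open>r\<close> at
  \<open>y\<close>, so it equals \<open>r\<close> somewhere on the connected set. Any
  \<open>b\<close> attaining the maximum there has \<open>z\<close> exactly on its sphere.\<close>

lemma connected_Max_dist_eq:
  fixes c :: "'b \<Rightarrow> 'a::metric_space"
  assumes "connected A" "finite B" "x \<in> A" "y \<in> A"
    and x: "\<And>b. b \<in> B \<Longrightarrow> dist (c b) x \<le> r"
    and y: "b0 \<in> B" "r \<le> dist (c b0) y"
  obtains z b where "z \<in> A" "b \<in> B" "dist (c b) z = r" "\<And>b'. b' \<in> B \<Longrightarrow> dist (c b') z \<le> r"
proof -
  let ?f = "\<lambda>z. Max ((\<lambda>b. dist (c b) z) ` B)"
  have ne: "B \<noteq> {}" using y by auto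
  have "continuous_on A ?f"
    using assms(2) ne
  proof (induction B rule: finite_ne_induct)
    case (singleton b)
    then show ?case by (simp add: continuous_intros)
  next
    case (insert b F)
    then show ?case by (simp add: continuous_intros)
  qed
  then have conn: "connected (?f ` A)"
    using assms(1) by (rule connected_continuous_image)
  have "?f x \<le> r" using assms(2) ne x by simp
  moreover have "r \<le> ?f y" using assms(2) ne y by (auto simp: Max_ge_iff)
  ultimately have "r \<in> ?f ` A"
    using connectedD_interval[OF conn] assms(3,4) by blast
  then obtain z where z: "z \<in> A" "?f z = r" by auto
  have "?f z \<in> (\<lambda>b. dist (c b) z) ` B" using assms(2) ne by (intro Max_in) auto
  then obtain b where "b \<in> B" "dist (c b) z = r" using z by auto
  moreover have "dist (c b') z \<le> r" if "b' \<in> B" for b'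
    using z(2) that assms(2) by (metis Max_ge finite_imageI imageI)
  ultimately show thesis using z that by blast
qed

text \<open>Supplies the far endpoint for the intermediate value argument. Of two antipodal points
  of the sphere, at least one does not lie on the side of \<open>a\<close> facing
  \<open>b\<close>.\<close>

lemma exists_sphere_point_far:
  fixes a b :: "'a::euclidean_space"
  assumes "r \<ge> 0"
  obtains y where "y \<in> sphere a r" "r \<le> dist b y"
proof -
  obtain u :: 'a where u: "norm u = r" using vector_choose_size[OF assms] .
  define v where "v = (if u \<bullet> (a - b) \<ge> 0 then u else - u)"
  have v: "norm v = r" "v \<bullet> (a - b) \<ge> 0" by (auto simp: v_def u)
  \<comment> \<open>\<open>v\<close> and \<open>a - b\<close> form no obtuse angle, so expanding the
    square adds only nonnegative terms to the squared norm of \<open>v\<close>.\<close>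
  have "r\<^sup>2 \<le> (norm ((a - b) + v))\<^sup>2"
    using v(2) unfolding v(1)[symmetric] power2_norm_eq_inner
    by (simp add: inner_add_left inner_add_right inner_commute)
  then have "r \<le> norm ((a - b) + v)" by (rule power2_le_imp_le) simp
  then have "r \<le> dist b (a + v)" by (simp add: dist_norm norm_minus_commute algebra_simps)
  moreover have "a + v \<in> sphere a r" by (simp add: dist_norm v)
  ultimately show thesis by (rule that[rotated])
qed

text \<open>The intermediate value lemma is used twice: over the whole space, to reach a point
  \<open>x\<close> on the sphere around some \<open>c a\<close>, then along that sphere with the
  remaining centers \<open>S - {a}\<close>. Dimension at least 2 makes the sphere connected.\<close>

lemma exists_two_sphere_point:
  fixes c :: "'b \<Rightarrow> 'a::euclidean_space"
  assumes "DIM('a) \<ge> 2" "r \<ge> 0" "finite S" "i \<in> S" "j \<in> S" "i \<noteq> j"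
    and q: "\<And>b. b \<in> S \<Longrightarrow> dist (c b) q \<le> r"
  obtains a b z where "a \<in> S" "b \<in> S" "a \<noteq> b" "z \<in> sphere (c a) r \<inter> sphere (c b) r"
    "\<And>s. s \<in> S \<Longrightarrow> dist (c s) z \<le> r"
proof -
  obtain y where y: "r \<le> dist (c i) y" using exists_sphere_point_far[OF assms(2)] by blast
  obtain x a where x: "a \<in> S" "dist (c a) x = r" "\<And>b. b \<in> S \<Longrightarrow> dist (c b) x \<le> r"
    using connected_Max_dist_eq[where c = c, OF connected_UNIV assms(3) UNIV_I UNIV_I q assms(4) y] by metis
  \<comment> \<open>\<open>a\<close> need not be \<open>i\<close>, but since \<open>i\<close> and
    \<open>j\<close> differ, one of them remains as a further center.\<close>
  obtain b0 where b0: "b0 \<in> S - {a}" using assms(4-6) by blast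
  obtain y' where y': "y' \<in> sphere (c a) r" "r \<le> dist (c b0) y'"
    using exists_sphere_point_far[OF assms(2)] by blast
  have S': "x \<in> sphere (c a) r" "finite (S - {a})"
      "\<And>b. b \<in> S - {a} \<Longrightarrow> dist (c b) x \<le> r"
    using x assms(3) by auto
  obtain z b where "z \<in> sphere (c a) r" "b \<in> S - {a}" "dist (c b) z = r"
      "\<And>b'. b' \<in> S - {a} \<Longrightarrow> dist (c b') z \<le> r"
    using connected_Max_dist_eq[where c = c,
        OF connected_sphere[OF assms(1)] S'(2,1) y'(1) S'(3) b0 y'(2)] by metis
  with x(1) show thesis by (intro that[of a b z]) auto
qed

text \<open>Reduces arbitrary positions in the plane to the collection: a lone target is a singleton
  of it, and a sensor sensing two or more targets can move to an intersection point without losing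
  any.\<close>

lemma targets_near_subset_mc_collection:
  assumes "sensing_range I > 0" "targets_near I q \<noteq> {}"
  shows "\<exists>A\<in>mc_collection I. targets_near I q \<subseteq> A"
proof -
  obtain i where i: "i \<in> targets_near I q" using assms(2) by blast
  show ?thesis
  proof (cases "targets_near I q = {i}")
    case True
    then show ?thesis using i unfolding mc_collection_def targets_near_def by blast
  next
    case False
    then obtain j where j: "j \<in> targets_near I q" "i \<noteq> j" using i by blast
    have fin: "finite (targets_near I q)" by (simp add: targets_near_def)
    obtain a b z where z: "a \<in> targets_near I q" "b \<in> targets_near I q" "a \<noteq> b"
        "z \<in> sphere (target_pos I a) (sensing_range I) \<inter> sphere (target_pos I b) (sensing_range I)"
        "\<And>s. s \<in> targets_near I q \<Longrightarrow> dist (target_pos I s) z \<le> sensing_range I"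
      by (rule exists_two_sphere_point[OF _ _ fin i j(1) j(2), of "sensing_range I" "target_pos I" q])
        (use assms in \<open>auto simp: targets_near_def\<close>)
    then have "z \<in> intersection_points I"
      unfolding intersection_points_def targets_near_def by blast
    moreover have "targets_near I q \<subseteq> targets_near I z"
      using z(5) by (auto simp: targets_near_def)
    ultimately show ?thesis unfolding mc_collection_def by blast
  qed
qed

section \<open>Greedy maximum coverage\<close>

lemma sum_UN_le:
  fixes f :: "'a \<Rightarrow> real"
  assumes "finite J" "finite (\<Union>j\<in>J. V j)" "\<And>x. x \<in> (\<Union>j\<in>J. V j) \<Longrightarrow> f x \<ge> 0"
  shows "sum f (\<Union>j\<in>J. V j) \<le> (\<Sum>j\<in>J. sum f (V j))"
  using assms
proof (induction J rule: finite_induct)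
  case empty
  show ?case by simp
next
  case (insert j J)
  let ?W = "\<Union>i\<in>J. V i"
  have fin: "finite (V j)" "finite ?W" using insert.prems(1) by simp_all
  have "sum f (V j \<inter> ?W) \<ge> 0" using insert.prems(2) by (intro sum_nonneg) auto
  then have "sum f (V j \<union> ?W) \<le> sum f (V j) + sum f ?W"
    using sum.union_inter[OF fin, of f] by linarith
  also have "sum f ?W \<le> (\<Sum>i\<in>J. sum f (V i))"
    using insert.IH[OF fin(2)] insert.prems(2) by blast
  finally show ?case using insert.hyps by simp
qed

lemma greedy_length: "greedy C \<tau> U k Gs \<Longrightarrow> length Gs \<le> k"
  by (induction rule: greedy.induct) auto

text \<open>\<open>V j\<close> stands for the targets covered by sensor \<open>j\<close> of a
  competing schedule. What greedy still misses of their union is spread over \<open>k\<close> sets,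
  each weighing at most the next greedy gain, so this gain closes at least a \<open>1 / k\<close>
  share of the gap.\<close>

lemma greedy_gap:
  fixes \<tau> :: "'a \<Rightarrow> real"
  assumes "greedy C \<tau> U k Gs" "finite U" "\<Union>C \<subseteq> U" "\<And>u. u \<in> U \<Longrightarrow> \<tau> u \<ge> 0"
    and V: "\<And>j. j < k \<Longrightarrow> V j = {} \<or> (\<exists>A\<in>C. V j \<subseteq> A)"
  shows "sum \<tau> (\<Union>j<k. V j) - sum \<tau> (\<Union>(set Gs)) \<le> (1 - 1 / k) ^ length Gs * sum \<tau> (\<Union>j<k. V j)"
  using assms(1)
proof (induction rule: greedy.induct)
  case start
  show ?case by simp
next
  case (select Gs A)
  let ?W = "\<Union>j<k. V j" and ?G = "\<Union>(set Gs)"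
  have G: "?G \<subseteq> U" using greedy_subset[OF select.hyps(1)] assms(3) by blast
  have A: "A \<subseteq> U" using select.hyps(4) assms(3) by blast
  have VU: "V j \<subseteq> U" if "j < k" for j using V[OF that] assms(3) by blast
  have k: "real k > 0" using select.hyps(2) by simp
  have gain: "sum \<tau> (V j - ?G) \<le> sum \<tau> (A - ?G)" if "j < k" for j
  proof (cases "V j = {}")
    case True
    then show ?thesis using A assms(4) by (auto intro!: sum_nonneg)
  next
    case False
    then obtain B where B: "B \<in> C" "V j \<subseteq> B" using V[OF \<open>j < k\<close>] by blast
    have BU: "B \<subseteq> U" using B assms(3) by blast
    then have "finite B" using assms(2) finite_subset by blast
    then have "sum \<tau> (V j - ?G) \<le> sum \<tau> (B - ?G)"
      using B BU assms(4) by (intro sum_mono2) auto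
    also have "\<dots> \<le> sum \<tau> (A - ?G)" using select.hyps(5)[OF B(1)] .
    finally show ?thesis .
  qed
  have finW: "finite ?W" using VU assms(2) finite_subset by blast
  have finG: "finite ?G" using G assms(2) finite_subset by blast
  have finA: "finite A" using A assms(2) finite_subset by blast
  have "sum \<tau> ?W - sum \<tau> ?G \<le> sum \<tau> (?W - ?G)"
  proof -
    have "sum \<tau> ?W = sum \<tau> (?W - ?G) + sum \<tau> (?W \<inter> ?G)"
      using finW by (metis sum.Int_Diff add.commute)
    moreover have "sum \<tau> (?W \<inter> ?G) \<le> sum \<tau> ?G"
      using finG G assms(4) by (intro sum_mono2) auto
    ultimately show ?thesis by simp
  qed
  also have "?W - ?G = (\<Union>j<k. V j - ?G)" by blast
  also have "sum \<tau> \<dots> \<le> (\<Sum>j<k. sum \<tau> (V j - ?G))"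
  proof (rule sum_UN_le)
    show "finite (\<Union>j<k. V j - ?G)" by (rule finite_subset[OF _ finW]) blast
  qed (use VU assms(4) in auto)
  also have "\<dots> \<le> real k * sum \<tau> (A - ?G)"
    using sum_bounded_above[of "{..<k}" "\<lambda>j. sum \<tau> (V j - ?G)"] gain by simp
  finally have "(sum \<tau> ?W - sum \<tau> ?G) / k \<le> sum \<tau> (A - ?G)"
    using k by (simp add: field_simps)
  moreover have "sum \<tau> (\<Union>(set (Gs @ [A]))) = sum \<tau> ?G + sum \<tau> (A - ?G)"
    using sum.union_disjoint[of ?G "A - ?G" \<tau>] finG finA by (simp add: Un_commute)
  ultimately have "sum \<tau> ?W - sum \<tau> (\<Union>(set (Gs @ [A])))
      \<le> (1 - 1 / k) * (sum \<tau> ?W - sum \<tau> ?G)"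
    by (simp add: left_diff_distrib)
  \<comment> \<open>A further selection requires \<open>k\<close> to be at least 1, so the factor is
    nonnegative and preserves the induction hypothesis.\<close>
  also have "\<dots> \<le> (1 - 1 / k) * ((1 - 1 / k) ^ length Gs * sum \<tau> ?W)"
    using select.IH k by (intro mult_left_mono) auto
  finally show ?case by simp
qed

lemma greedy_result_approximation:
  fixes \<tau> :: "'a \<Rightarrow> real"
  assumes "greedy_result C \<tau> U k Gs" "finite U" "\<Union>C \<subseteq> U" "\<And>u. u \<in> U \<Longrightarrow> \<tau> u \<ge> 0"
    and V: "\<And>j. j < k \<Longrightarrow> V j = {} \<or> (\<exists>A\<in>C. V j \<subseteq> A)"
  shows "(1 - 1 / exp 1) * sum \<tau> (\<Union>j<k. V j) \<le> sum \<tau> (\<Union>(set Gs))"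
proof -
  let ?W = "\<Union>j<k. V j"
  have WU: "?W \<subseteq> U" using V assms(3) by blast
  have W0: "sum \<tau> ?W \<ge> 0" using WU assms(4) by (intro sum_nonneg) auto
  \<comment> \<open>The exponential bound needs positive \<open>k\<close>. If greedy has covered all
    of \<open>U\<close>, no competitor can weigh more.\<close>
  consider "k = 0" | "\<Union>(set Gs) = U" | "k > 0" "length Gs = k"
    using assms(1) by (auto simp: greedy_result_def)
  then show ?thesis
  proof cases
    case 1
    then have "Gs = []" using greedy_length[of C \<tau> U k Gs] assms(1) by (simp add: greedy_result_def)
    with 1 show ?thesis by simp
  next
    case 2
    have "(1 - 1 / exp 1) * sum \<tau> ?W \<le> sum \<tau> ?W" using W0 by (simp add: mult_left_le_one_le)
    also have "\<dots> \<le> sum \<tau> U" using WU assms(2,4) by (intro sum_mono2) auto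
    finally show ?thesis using 2 by simp
  next
    case 3
    have "sum \<tau> ?W - sum \<tau> (\<Union>(set Gs)) \<le> (1 - 1 / k) ^ k * sum \<tau> ?W"
      using greedy_gap[of C \<tau> U k Gs V] assms 3 by (simp add: greedy_result_def)
    \<comment> \<open>This is \<open>(1 - x / n) ^ n \<le> exp (- x)\<close> at \<open>x = 1\<close>
      and \<open>n = k\<close>.\<close>
    also have "\<dots> \<le> exp (- 1) * sum \<tau> ?W"
      using exp_ge_one_minus_x_over_n_power_n[of 1 k] 3 W0 by (intro mult_right_mono) auto
    finally show ?thesis by (simp add: exp_minus field_simps)
  qed
qed

section \<open>The schedule computed by WMCBA\<close>

lemma covered_targets_eq_UN:
  "covered_targets I X = (\<Union>j<num_sensors I. targets_near I (X j))"
  by (auto simp: covered_targets_def targets_near_def dist_commute)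

lemma opt_weight_attained: "\<exists>Y. opt_weight I = covered_weight I Y"
  using Max_in[OF finite_range_covered_weight[of I]] by (auto simp: opt_weight_def)

lemma communicating_if_relevant:
  assumes "valid_instance I" "\<And>j. j < num_sensors I \<Longrightarrow> X j \<in> relevant_region I"
  shows "communicating I X"
proof -
  have "sink I \<in> relevant_region I" by (simp add: relevant_region_def)
  then show ?thesis using assms by (auto simp: communicating_def valid_instance_def)
qed

lemma placed_at_relevant:
  assumes "destination_of I A d" "placed_at I j d q"
  shows "q \<in> relevant_region I"
proof -
  have "\<exists>i<num_targets I. q \<in> cball (target_pos I i) (sensing_range I)"
    using assms unfolding destination_of_def intersection_points_def by (auto simp: dist_commute)
  then show ?thesis unfolding relevant_region_def by blast
qed

lemma placed_at_covers:
  assumes "destination_of I A d" "placed_at I j d q"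
  shows "A \<subseteq> targets_near I q"
  using assms unfolding destination_of_def targets_near_def by (auto simp: dist_commute)

text \<open>Each sensor ends within sensing range of a target or, if its destination is a dummy, at
  its initial position. Both lie in the region that the transmission range spans.\<close>

lemma wmcba_communicating:
  assumes "valid_instance I" "wmcba_output I X"
  shows "communicating I X"
proof (rule communicating_if_relevant[OF assms(1)])
  fix j assume j: "j < num_sensors I"
  obtain Gs Ds \<sigma> where
      Gs: "greedy_result (mc_collection I) (target_weight I) {..<num_targets I} (num_sensors I) Gs"
    and Ds: "list_all2 (destination_of I) Gs Ds"
    and \<sigma>: "min_cost_assignment I (Ds @ replicate (num_sensors I - length Ds) Dummy) \<sigma>"
    and X: "\<forall>j<num_sensors I.
       placed_at I j ((Ds @ replicate (num_sensors I - length Ds) Dummy) ! \<sigma> j) (X j)"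
    using assms(2) unfolding wmcba_output_def by blast
  \<comment> \<open>Hence the padded list has exactly \<open>num_sensors I\<close> entries, and
    \<open>\<sigma> j\<close> addresses either a real destination or a dummy.\<close>
  have "length Ds \<le> num_sensors I"
    using Gs greedy_length list_all2_lengthD[OF Ds] by (fastforce simp: greedy_result_def)
  moreover have "\<sigma> j < num_sensors I"
    using \<sigma> j permutes_in_image[of \<sigma>] by (fastforce simp: min_cost_assignment_def)
  ultimately consider "\<sigma> j < length Ds" "placed_at I j (Ds ! \<sigma> j) (X j)"
    | "placed_at I j Dummy (X j)"
    using X j by (cases "\<sigma> j < length Ds") (auto simp: nth_append)
  then show "X j \<in> relevant_region I"
  proof cases
    case 1
    then show ?thesis
      using placed_at_relevant list_all2_nthD2[OF Ds] by blast
  next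
    case 2
    then show ?thesis using j by (simp add: relevant_region_def)
  qed
qed

text \<open>A permutation is onto, so every selected set is served by some sensor, whose final
  position senses the whole set.\<close>

lemma wmcba_covers_greedy:
  assumes "wmcba_output I X"
  obtains Gs where
    "greedy_result (mc_collection I) (target_weight I) {..<num_targets I} (num_sensors I) Gs"
    "\<Union>(set Gs) \<subseteq> covered_targets I X"
proof -
  obtain Gs Ds \<sigma> where
      Gs: "greedy_result (mc_collection I) (target_weight I) {..<num_targets I} (num_sensors I) Gs"
    and Ds: "list_all2 (destination_of I) Gs Ds"
    and \<sigma>: "min_cost_assignment I (Ds @ replicate (num_sensors I - length Ds) Dummy) \<sigma>"
    and X: "\<forall>j<num_sensors I.
       placed_at I j ((Ds @ replicate (num_sensors I - length Ds) Dummy) ! \<sigma> j) (X j)"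
    using assms unfolding wmcba_output_def by blast
  have len: "length Ds \<le> num_sensors I" "length Gs = length Ds"
    using Gs greedy_length list_all2_lengthD[OF Ds] by (fastforce simp: greedy_result_def)+
  have "A \<subseteq> covered_targets I X" if A: "A \<in> set Gs" for A
  proof -
    obtain l where l: "l < length Gs" "A = Gs ! l" using A by (auto simp: in_set_conv_nth)
    have perm: "\<sigma> permutes {..<num_sensors I}" using \<sigma> by (simp add: min_cost_assignment_def)
    have "l \<in> \<sigma> ` {..<num_sensors I}" using permutes_image[OF perm] l len by simp
    then obtain j where j: "j < num_sensors I" "\<sigma> j = l" by auto
    have "placed_at I j (Ds ! l) (X j)" using X j l len by (auto simp: nth_append)
    then have "A \<subseteq> targets_near I (X j)"
      using placed_at_covers list_all2_nthD[OF Ds l(1)] l(2) by blast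
    then show ?thesis using j by (auto simp: covered_targets_eq_UN)
  qed
  then show thesis using that[OF Gs] by blast
qed

theorem theorem3:
  fixes I :: rmwtcsclms and X :: "nat \<Rightarrow> real^2"
  assumes "valid_instance I"
    and "wmcba_output I X"
  shows "communicating I X \<and>
    covered_weight I X \<ge> (1 - 1 / exp 1) * opt_weight I"
proof
  show "communicating I X" using assms by (rule wmcba_communicating)
  have R: "sensing_range I > 0" and w: "\<And>i. i \<in> {..<num_targets I} \<Longrightarrow> target_weight I i \<ge> 0"
    using assms(1) by (auto simp: valid_instance_def)
  obtain Gs where
      Gs: "greedy_result (mc_collection I) (target_weight I) {..<num_targets I} (num_sensors I) Gs"
    and cov: "\<Union>(set Gs) \<subseteq> covered_targets I X"
    using wmcba_covers_greedy[OF assms(2)] by blast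
  obtain Y where Y: "opt_weight I = covered_weight I Y" using opt_weight_attained by blast
  have "\<Union>(mc_collection I) \<subseteq> {..<num_targets I}"
    unfolding mc_collection_def targets_near_def by auto
  then have "(1 - 1 / exp 1) * opt_weight I \<le> sum (target_weight I) (\<Union>(set Gs))"
    unfolding Y covered_weight_def covered_targets_eq_UN
  proof (rule greedy_result_approximation[OF Gs finite_lessThan _ w])
    \<comment> \<open>The competitor is an optimal schedule \<open>Y\<close>; its sensors that sense
      nothing fall under the first alternative.\<close>
    show "targets_near I (Y j) = {} \<or> (\<exists>A\<in>mc_collection I. targets_near I (Y j) \<subseteq> A)" for j
      using targets_near_subset_mc_collection[OF R, of "Y j"] by blast
  qed
  also have "\<dots> \<le> covered_weight I X"
    unfolding covered_weight_def using cov w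
    by (intro sum_mono2) (auto simp: covered_targets_def)
  finally show "covered_weight I X \<ge> (1 - 1 / exp 1) * opt_weight I" .
qed

end
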